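(* For every integer $k\ge2$, $$C_{+}(k-1)=\zeta(k)^2(2\gamma-1)+2\zeta^{*}(k,k,1)+\zeta^{*}(2k,1).$$ Moreover, one has the relation $2\zeta^{*}(1,1,1)+\zeta^{*}(2,1)=-\frac43\zeta(3)$, and consequently $$C_0=-2+4\gamma-3\gamma^2+\frac43\gamma^3+2(1-\gamma)\gamma_1+\gamma_2+2\zeta^{*}(1,1,1)+\zeta^{*}(2,1).$$
   Context: $\zeta$ is the Riemann zeta-function. The Stieltjes constants $\gamma=\gamma_0,\gamma_1,\gamma_2,\dots$ are defined by $\zeta(1+w)=\frac1w+\sum_{j\ge0}\frac{(-1)^j\gamma_j}{j!}w^j$. For $w\in\mathbb C$, $H_N^{(w)}:=\sum_{m=1}^N m^{-w}$, $H_0^{(w)}:=0$, and $H_N:=H_N^{(1)}$. For $a\in\mathbb C$ with $\Re a>0$, $$C_{+}(a):=|\zeta(1+a)|^2(2\gamma-1)+\sum_{n=1}^{\infty}\frac{|H_{n-1}^{(1+a)}|^2-|\zeta(1+a)|^2}{n}$$ (an absolutely convergent series), and $$C_0:=-2+4\gamma-3\gamma^2+\tfrac43\gamma^3+2(1-\gamma)\gamma_1+\gamma_2-\tfrac43\zeta(3).$$ Harmonic regularization: for a tuple $\boldsymbol k=(k_1,\dots,k_r)$ of positive integers put $$\zeta_N(\boldsymbol k):=\sum_{1\le n_1<\cdots<n_r\le N}\frac1{n_1^{k_1}\cdots n_r^{k_r}}.$$ There is a unique polynomial $\zeta^{*}(\boldsymbol k;Y)\in\mathcal Z[Y]$, where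 $\mathcal Z$ is the algebra generated by the convergent multiple zeta values, such that $\zeta_N(\boldsymbol k)=\zeta^{*}(\boldsymbol k;H_N)+o(1)$ as $N\to\infty$. One writes $\zeta^{*}(\boldsymbol k):=\zeta^{*}(\boldsymbol k;0)$ for its constant term. *)

theory Defs
  imports "HOL-Complex_Analysis.Complex_Analysis" "HOL-Computational_Algebra.Polynomial"
begin

definition zeta_series :: "complex \<Rightarrow> complex" where
  "zeta_series s = (\<Sum>n. of_nat (Suc n) powr (- s))"

(* The continuation is unique by the identity theorem, since the complement of {1} is
   connected; the value 0 at the pole is a convention. *)
definition zeta :: "complex \<Rightarrow> complex" where
  "zeta s = (if Re s > 1 then zeta_series s
     else (THE f. f holomorphic_on (- {1}) \<and> f 1 = 0 \<and>
                  (\<forall>z. Re z > 1 \<longrightarrow> f z = zeta_series z)) s)"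

definition stieltjes :: "nat \<Rightarrow> complex" where
  "stieltjes = (THE g. \<exists>r>0. \<forall>w. 0 < norm w \<and> norm w < r \<longrightarrow>
     (\<lambda>j. (- 1) ^ j * g j / fact j * w ^ j) sums (zeta (1 + w) - 1 / w))"

definition gen_harm :: "complex \<Rightarrow> nat \<Rightarrow> complex" where
  "gen_harm w N = (\<Sum>m = 1..N. of_nat m powr (- w))"

(* The series over n = 1, 2, ... is indexed from 0, so that gen_harm (1 + a) n is
   the harmonic number of index n - 1. *)
definition C_plus :: "complex \<Rightarrow> complex" where
  "C_plus a = of_real ((norm (zeta (1 + a)))\<^sup>2) * (2 * stieltjes 0 - 1) +
     of_real (\<Sum>n. ((norm (gen_harm (1 + a) n))\<^sup>2 - (norm (zeta (1 + a)))\<^sup>2) / real (Suc n))"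

definition C_zero :: complex where
  "C_zero = - 2 + 4 * stieltjes 0 - 3 * (stieltjes 0)\<^sup>2 + 4 / 3 * stieltjes 0 ^ 3
     + 2 * (1 - stieltjes 0) * stieltjes 1 + stieltjes 2 - 4 / 3 * zeta 3"

definition mzv_trunc :: "nat \<Rightarrow> nat list \<Rightarrow> real" where
  "mzv_trunc N ks =
     (\<Sum>ns | length ns = length ks \<and> sorted_wrt (<) ns \<and> set ns \<subseteq> {1..N}.
        1 / (\<Prod>i<length ks. real (ns ! i) ^ (ks ! i)))"

(* The largest summation index carries the last exponent, so convergence means that the
   last exponent is at least 2. The algebra is taken over the rationals. *)
inductive_set mzv_algebra :: "real set" where
  rat: "q \<in> \<rat> \<Longrightarrow> q \<in> mzv_algebra"
| mzv: "\<lbrakk>ks \<noteq> []; \<forall>k\<in>set ks. k \<ge> 1; last ks \<ge> 2\<rbrakk> \<Longrightarrow>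
          lim (\<lambda>N. mzv_trunc N ks) \<in> mzv_algebra"
| add: "\<lbrakk>x \<in> mzv_algebra; y \<in> mzv_algebra\<rbrakk> \<Longrightarrow> x + y \<in> mzv_algebra"
| mult: "\<lbrakk>x \<in> mzv_algebra; y \<in> mzv_algebra\<rbrakk> \<Longrightarrow> x * y \<in> mzv_algebra"

definition zeta_star_poly :: "nat list \<Rightarrow> real poly" where
  "zeta_star_poly ks = (THE p. (\<forall>i. coeff p i \<in> mzv_algebra) \<and>
     (\<lambda>N. mzv_trunc N ks - poly p (harm N)) \<longlonglongrightarrow> 0)"

definition zeta_star :: "nat list \<Rightarrow> real" where
  "zeta_star ks = poly (zeta_star_poly ks) 0"

end

theory Submission
  imports Defs "HOL-Real_Asymp.Real_Asymp"
begin

text \<open>Expanding the square of \<open>\<zeta>\<^sub>n(k)\<close> by the harmonic product turns the partial sums of the series for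
  \<open>C\<^sub>+(k - 1)\<close> into \<open>2 \<zeta>\<^sub>N(k,k,1) + \<zeta>\<^sub>N(2k,1) - \<zeta>(k)\<^sup>2 H\<^sub>N\<close>. The harmonic product with \<open>H\<^sub>N = \<zeta>\<^sub>N(1)\<close>
  writes both truncated values as a convergent \<open>\<zeta>\<^sub>N\<close> times \<open>H\<^sub>N\<close> minus convergent multiple zeta values.
  Since \<open>(\<zeta>(\<^bold>k) - \<zeta>\<^sub>N(\<^bold>k)) H\<^sub>N \<rightarrow> 0\<close>, the regularization polynomials are linear, and
  \<open>2 \<zeta>\<^sup>*(k,k,1) + \<zeta>\<^sup>*(2k,1)\<close> is the limit of the partial sums. The relation among the regularized values reduces,
  after computing \<open>\<zeta>\<^sup>*(1,1,1) = \<zeta>(3) / 3\<close> from Newton's identities, to Euler's \<open>\<zeta>(1,2) = \<zeta>(3)\<close>.\<close>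

section \<open>Truncated multiple zeta values: recursion in the truncation bound\<close>

lemma mzv_trunc_Nil [simp]: "mzv_trunc N [] = 1"
proof -
  have "{ns::nat list. length ns = length ([]::nat list) \<and> sorted_wrt (<) ns \<and> set ns \<subseteq> {1..N}} = {[]}"
    by auto
  then show ?thesis by (simp add: mzv_trunc_def)
qed

lemma finite_index_set: "finite {ns. length ns = r \<and> sorted_wrt (<) ns \<and> set ns \<subseteq> {1..N::nat}}"
  by (rule finite_subset[OF _ finite_lists_length_eq[of "{1..N}" r]]) auto

text \<open>The last entry of an increasing tuple is its largest, so either it equals
  \<open>Suc N\<close> and can be removed, or the whole tuple already lies below. This yields the
  recursion on which every later induction over the truncation bound rests.\<close>

lemma index_sets_Suc:
  "{ns. length ns = Suc r \<and> sorted_wrt (<) ns \<and> set ns \<subseteq> {1..Suc N}} =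
   {ns. length ns = Suc r \<and> sorted_wrt (<) ns \<and> set ns \<subseteq> {1..N}} \<union>
   (\<lambda>ns. ns @ [Suc N]) ` {ns. length ns = r \<and> sorted_wrt (<) ns \<and> set ns \<subseteq> {1..N}}"
  (is "?L = ?A \<union> ?f ` ?B")
proof (intro equalityI subsetI)
  fix ns assume "ns \<in> ?L"
  then have l: "length ns = Suc r" and s: "sorted_wrt (<) ns" and u: "set ns \<subseteq> {1..Suc N}" by auto
  from l obtain ms m where ns: "ns = ms @ [m]" by (metis append_butlast_last_id length_0_conv nat.distinct(1))
  have ms: "sorted_wrt (<) ms" "\<And>x. x \<in> set ms \<Longrightarrow> x < m" using s by (auto simp: ns sorted_wrt_append)
  show "ns \<in> ?A \<union> ?f ` ?B"
  proof (cases "m = Suc N")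
    case True
    then have "ms \<in> ?B" using l ms u by (fastforce simp: ns)
    then show ?thesis by (auto simp: ns True)
  next
    case False
    have "set ns \<subseteq> {1..N}"
      using u ms(2) False by (fastforce simp: ns)
    then show ?thesis using l s by auto
  qed
next
  fix ns assume "ns \<in> ?A \<union> ?f ` ?B"
  then show "ns \<in> ?L" by (fastforce simp: sorted_wrt_append)
qed

lemma mzv_trunc_Suc:
  "mzv_trunc (Suc N) (ks @ [k]) = mzv_trunc N (ks @ [k]) + mzv_trunc N ks / real (Suc N) ^ k"
proof -
  let ?I = "\<lambda>r N. {ns. length ns = r \<and> sorted_wrt (<) ns \<and> set ns \<subseteq> {1..N::nat}}"
  let ?r = "length ks"
  let ?g = "\<lambda>ns. 1 / (\<Prod>i<Suc ?r. real (ns ! i) ^ ((ks @ [k]) ! i))"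
  have g: "?g (ns @ [Suc N]) = (1 / (\<Prod>i<?r. real (ns ! i) ^ (ks ! i))) / real (Suc N) ^ k"
    if "length ns = ?r" for ns
  proof -
    have "(\<Prod>i<?r. real ((ns @ [Suc N]) ! i) ^ ((ks @ [k]) ! i)) = (\<Prod>i<?r. real (ns ! i) ^ (ks ! i))"
      using that by (intro prod.cong) (auto simp: nth_append)
    then show ?thesis using that by (simp add: nth_append)
  qed
  have "mzv_trunc (Suc N) (ks @ [k]) = sum ?g (?I (Suc ?r) (Suc N))"
    by (simp add: mzv_trunc_def)
  also have "\<dots> = sum ?g (?I (Suc ?r) N) + sum ?g ((\<lambda>ns. ns @ [Suc N]) ` ?I ?r N)"
    unfolding index_sets_Suc
    by (intro sum.union_disjoint finite_imageI finite_index_set) auto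
  also have "sum ?g (?I (Suc ?r) N) = mzv_trunc N (ks @ [k])"
    by (simp add: mzv_trunc_def)
  also have "sum ?g ((\<lambda>ns. ns @ [Suc N]) ` ?I ?r N) = (\<Sum>ns\<in>?I ?r N. ?g (ns @ [Suc N]))"
    by (subst sum.reindex) (auto simp: inj_on_def)
  also have "\<dots> = (\<Sum>ns\<in>?I ?r N. (1 / (\<Prod>i<?r. real (ns ! i) ^ (ks ! i))) / real (Suc N) ^ k)"
    by (intro sum.cong refl g) auto
  also have "\<dots> = mzv_trunc N ks / real (Suc N) ^ k"
    by (simp add: mzv_trunc_def sum_divide_distrib)
  finally show ?thesis .
qed

lemma mzv_trunc_0: "mzv_trunc 0 (ks @ [k]) = 0"
proof -
  have "{ns::nat list. length ns = length (ks @ [k]) \<and> sorted_wrt (<) ns \<and> set ns \<subseteq> {1..0}} = {}"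
    by auto
  then show ?thesis unfolding mzv_trunc_def by (simp only: sum.empty)
qed

text \<open>The outermost index is \<open>Suc n\<close>, so strict increase confines the inner
  indices to at most \<open>n\<close>; this is why the inner truncation carries no shift.\<close>

lemma mzv_trunc_snoc:
  "mzv_trunc N (ks @ [k]) = (\<Sum>n<N. mzv_trunc n ks / real (Suc n) ^ k)"
  by (induction N) (simp_all add: mzv_trunc_0 mzv_trunc_Suc)

lemma mzv_trunc_nonneg: "mzv_trunc N ks \<ge> 0"
  unfolding mzv_trunc_def by (intro sum_nonneg divide_nonneg_nonneg prod_nonneg) auto

section \<open>Uniqueness of the regularization polynomial\<close>

lemma harm_le_ln: "harm (Suc n) \<le> ln (real (Suc n)) + 1"
  using euler_mascheroni_sequence_decreasing[of 1 "Suc n"] by (simp add: harm_def)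

text \<open>A polynomial with positive leading coefficient eventually stays above that coefficient,
  and \<open>harm\<close> is unbounded, so its values along \<open>harm\<close> cannot tend to 0.
  Applied to both \<open>p - q\<close> and \<open>q - p\<close>, this forces the leading coefficient
  of the difference to vanish.\<close>

lemma poly_harm_unique:
  fixes p q :: "real poly"
  assumes "(\<lambda>N. f N - poly p (harm N)) \<longlonglongrightarrow> 0" "(\<lambda>N. f N - poly q (harm N)) \<longlonglongrightarrow> 0"
  shows "p = q"
proof -
  have no: "\<not> lead_coeff r > 0" if "(\<lambda>N. poly r (harm N :: real)) \<longlonglongrightarrow> 0" for r
  proof
    assume "lead_coeff r > 0"
    from poly_pinfty_gt_lc[OF this] obtain x0 where x0: "\<And>x. x \<ge> x0 \<Longrightarrow> lead_coeff r \<le> poly r x" by auto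
    have "eventually (\<lambda>N. harm N \<ge> x0) sequentially"
      using harm_at_top unfolding filterlim_at_top by auto
    then have "eventually (\<lambda>N. lead_coeff r \<le> poly r (harm N)) sequentially"
      by eventually_elim (rule x0)
    then have "lead_coeff r \<le> 0"
      using that by (intro tendsto_lowerbound[where F = sequentially]) auto
    with \<open>lead_coeff r > 0\<close> show False by simp
  qed
  have "(\<lambda>N. poly (p - q) (harm N)) \<longlonglongrightarrow> 0" "(\<lambda>N. poly (q - p) (harm N)) \<longlonglongrightarrow> 0"
    using tendsto_diff[OF assms] tendsto_diff[OF assms(2,1)] by simp_all
  then have "\<not> lead_coeff (p - q) > 0" "\<not> lead_coeff (q - p) > 0"
    using no by blast+
  moreover have "lead_coeff (q - p) = - lead_coeff (p - q)"
    by (metis lead_coeff_minus minus_diff_eq)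
  ultimately have "lead_coeff (p - q) = 0" by linarith
  then have "p - q = 0" by (simp only: leading_coeff_0_iff)
  then show "p = q" by simp
qed

text \<open>Resolves the definite description: to compute a regularized value it suffices to exhibit
  one suitable polynomial.\<close>

lemma zeta_star_poly_eqI:
  assumes "\<And>i. coeff p i \<in> mzv_algebra"
    and "(\<lambda>N. mzv_trunc N ks - poly p (harm N)) \<longlonglongrightarrow> 0"
  shows "zeta_star_poly ks = p"
  unfolding zeta_star_poly_def using assms by (intro the_equality) (auto intro: poly_harm_unique)

section \<open>Convergence of multiple zeta values and decay of their tails\<close>

lemma summable_harm_power:
  assumes "k \<ge> 2"
  shows "summable (\<lambda>n. harm (Suc n) ^ r / real (Suc n) ^ k)"
proof (rule summable_comparison_test)
  \<comment> \<open>The exponent -3/2 leaves room above -2 to absorb any power of the logarithm, and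
    stays below -1 for summability.\<close>
  have "(\<lambda>n::nat. (ln (real (Suc n)) + 1) ^ r / real (Suc n) ^ 2) \<in> O(\<lambda>n. real n powr (-3/2))"
    by real_asymp
  then show "summable (\<lambda>n::nat. (ln (real (Suc n)) + 1) ^ r / real (Suc n) ^ 2)"
    by (rule summable_comparison_test_bigo[rotated]) (simp add: summable_real_powr_iff)
  have "harm (Suc n) ^ r / real (Suc n) ^ k \<le> (ln (real (Suc n)) + 1) ^ r / real (Suc n) ^ 2" for n
  proof (rule frac_le)
    show "harm (Suc n) ^ r \<le> (ln (real (Suc n)) + 1) ^ r"
      by (rule power_mono[OF harm_le_ln harm_nonneg])
    then show "0 \<le> (ln (real (Suc n)) + 1) ^ r"
      using zero_le_power[OF harm_nonneg[of "Suc n", where 'a = real], of r] by linarith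
    show "real (Suc n) ^ 2 \<le> real (Suc n) ^ k"
      by (rule power_increasing[OF assms]) simp
  qed simp
  then show "\<exists>N. \<forall>n\<ge>N. norm (harm (Suc n) ^ r / real (Suc n) ^ k)
      \<le> (ln (real (Suc n)) + 1) ^ r / real (Suc n) ^ 2"
    by (auto simp: harm_nonneg simp del: of_nat_Suc)
qed

lemma harm_eq_sum: "harm N = (\<Sum>n<N. 1 / real (Suc n))"
  by (induction N) (simp_all add: harm_Suc harm_def inverse_eq_divide)

text \<open>Forgetting the order of the indices and lowering every exponent to 1 leaves a product of
  harmonic sums, so truncated values grow at most like a power of log N.\<close>

lemma mzv_trunc_le_harm_power:
  assumes "\<forall>k\<in>set ks. k \<ge> 1"
  shows "mzv_trunc N ks \<le> harm N ^ length ks"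
  using assms
proof (induction ks arbitrary: N rule: rev_induct)
  case Nil
  then show ?case by simp
next
  case (snoc k ks)
  have "mzv_trunc n ks / real (Suc n) ^ k \<le> harm N ^ length ks * (1 / real (Suc n))" if "n < N" for n
  proof -
    have "mzv_trunc n ks \<le> harm n ^ length ks" using snoc by simp
    also have "\<dots> \<le> harm N ^ length ks"
      using that by (intro power_mono harm_mono harm_nonneg) auto
    finally have "mzv_trunc n ks / real (Suc n) ^ k \<le> harm N ^ length ks / real (Suc n) ^ 1"
      using snoc.prems by (intro frac_le power_increasing zero_le_power harm_nonneg) auto
    then show ?thesis by simp
  qed
  then have "mzv_trunc N (ks @ [k]) \<le> (\<Sum>n<N. harm N ^ length ks * (1 / real (Suc n)))"
    unfolding mzv_trunc_snoc by (intro sum_mono) auto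
  also have "\<dots> = harm N ^ length (ks @ [k])"
    unfolding sum_distrib_left[symmetric] harm_eq_sum[symmetric] by simp
  finally show ?case .
qed

definition mzv :: "nat list \<Rightarrow> real" where
  "mzv ks = lim (\<lambda>N. mzv_trunc N ks)"

text \<open>The weight \<open>harm (Suc n)\<close> prepares the tail estimate; it costs only one
  more logarithmic factor against an exponent of at least 2.\<close>

lemma summable_mzv_harm:
  assumes "\<forall>i\<in>set ks. i \<ge> 1" "k \<ge> 2"
  shows "summable (\<lambda>n. mzv_trunc n ks / real (Suc n) ^ k * harm (Suc n))"
proof (rule summable_comparison_test)
  show "summable (\<lambda>n. harm (Suc n) ^ Suc (length ks) / real (Suc n) ^ k)"
    using assms by (intro summable_harm_power)
  have "mzv_trunc n ks / real (Suc n) ^ k * harm (Suc n)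
      \<le> harm (Suc n) ^ Suc (length ks) / real (Suc n) ^ k" for n
  proof -
    have "mzv_trunc n ks \<le> harm n ^ length ks" using assms by (intro mzv_trunc_le_harm_power) auto
    also have "\<dots> \<le> harm (Suc n) ^ length ks"
      by (intro power_mono harm_mono harm_nonneg) auto
    finally have "mzv_trunc n ks * harm (Suc n) \<le> harm (Suc n) ^ length ks * harm (Suc n)"
      by (intro mult_right_mono harm_nonneg)
    then show ?thesis by (simp add: divide_right_mono mult.commute)
  qed
  then show "\<exists>N. \<forall>n\<ge>N. norm (mzv_trunc n ks / real (Suc n) ^ k * harm (Suc n))
      \<le> harm (Suc n) ^ Suc (length ks) / real (Suc n) ^ k"
    by (auto simp: harm_nonneg mzv_trunc_nonneg simp del: of_nat_Suc power_Suc)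
qed

lemma harm_Suc_ge_1: "harm (Suc n) \<ge> (1::real)"
  using harm_mono[of 1 "Suc n", where 'a = real] by (simp add: harm_def)

text \<open>In the tail beyond \<open>N\<close>, every term has \<open>harm N\<close> at most
  \<open>harm (Suc n)\<close> for its own index. Hence the tail times \<open>harm N\<close> is
  bounded by the tail of the weighted convergent series, which tends to 0.\<close>

lemma
  assumes "\<forall>i\<in>set ks. i \<ge> 1" "k \<ge> 2"
  shows mzv_trunc_LIMSEQ_snoc: "(\<lambda>N. mzv_trunc N (ks @ [k])) \<longlonglongrightarrow> mzv (ks @ [k])"
    and mzv_tail_harm: "(\<lambda>N. (mzv (ks @ [k]) - mzv_trunc N (ks @ [k])) * harm N) \<longlonglongrightarrow> 0"
proof -
  define a where "a n = mzv_trunc n ks / real (Suc n) ^ k" for n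
  have a0: "a n \<ge> 0" for n by (simp add: a_def mzv_trunc_nonneg)
  have sb: "summable (\<lambda>n. a n * harm (Suc n))"
    unfolding a_def by (rule summable_mzv_harm[OF assms])
  \<comment> \<open>Since \<open>harm (Suc n)\<close> is at least 1, the weighted series dominates
    the unweighted one.\<close>
  have "norm (a n) \<le> a n * harm (Suc n)" for n
    using mult_left_mono[OF harm_Suc_ge_1 a0, of n n] a0[of n] by simp
  then have sa: "summable a"
    using sb by (intro summable_comparison_test[of a]) auto
  have tr: "mzv_trunc N (ks @ [k]) = (\<Sum>n<N. a n)" for N
    by (simp add: mzv_trunc_snoc a_def)
  show *: "(\<lambda>N. mzv_trunc N (ks @ [k])) \<longlonglongrightarrow> mzv (ks @ [k])"
    unfolding mzv_def tr using summable_LIMSEQ[OF sa] by (simp add: limI)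
  then have m: "mzv (ks @ [k]) = suminf a"
    unfolding tr using summable_LIMSEQ[OF sa] by (rule LIMSEQ_unique)
  have t: "suminf f - (\<Sum>n<N. f n) = (\<Sum>n. f (n + N))" if "summable f" for f :: "nat \<Rightarrow> real" and N
    using suminf_split_initial_segment[OF that, of N] by simp
  show "(\<lambda>N. (mzv (ks @ [k]) - mzv_trunc N (ks @ [k])) * harm N) \<longlonglongrightarrow> 0"
  proof (rule tendsto_sandwich[OF _ _ tendsto_const])
    show "(\<lambda>N. suminf (\<lambda>n. a n * harm (Suc n)) - (\<Sum>n<N. a n * harm (Suc n))) \<longlonglongrightarrow> 0"
      using tendsto_diff[OF tendsto_const[of "\<Sum>n. a n * harm (Suc n)"] summable_LIMSEQ[OF sb]] by simp
    have "0 \<le> (\<Sum>n. a (n + N))" for N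
      by (intro suminf_nonneg a0) (use sa in \<open>simp add: summable_iff_shift\<close>)
    then show "\<forall>\<^sub>F N in sequentially. 0 \<le> (mzv (ks @ [k]) - mzv_trunc N (ks @ [k])) * harm N"
      by (auto simp: m tr t[OF sa] harm_nonneg)
    have "(\<Sum>n. a (n + N)) * harm N \<le> (\<Sum>n. a (n + N) * harm (Suc (n + N)))" for N
    proof -
      have "summable (\<lambda>n. a (n + N))" using sa by (simp add: summable_iff_shift)
      then have "(\<Sum>n. a (n + N)) * harm N = (\<Sum>n. a (n + N) * harm N)"
        by (rule suminf_mult2)
      also have "\<dots> \<le> (\<Sum>n. a (n + N) * harm (Suc (n + N)))"
      proof (rule suminf_le)
        show "a (n + N) * harm N \<le> a (n + N) * harm (Suc (n + N))" for n
          by (intro mult_left_mono harm_mono a0) auto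
        show "summable (\<lambda>n. a (n + N) * harm N)"
          using \<open>summable (\<lambda>n. a (n + N))\<close> by (rule summable_mult2)
        show "summable (\<lambda>n. a (n + N) * harm (Suc (n + N)))"
          using summable_ignore_initial_segment[OF sb, of N] by simp
      qed
      finally show ?thesis .
    qed
    then show "\<forall>\<^sub>F N in sequentially. (mzv (ks @ [k]) - mzv_trunc N (ks @ [k])) * harm N
        \<le> suminf (\<lambda>n. a n * harm (Suc n)) - (\<Sum>n<N. a n * harm (Suc n))"
      by (auto simp: m tr t[OF sa] t[OF sb])
  qed
qed

lemma mzv_trunc_LIMSEQ:
  assumes "ks \<noteq> []" "\<forall>k\<in>set ks. k \<ge> 1" "last ks \<ge> 2"
  shows "(\<lambda>N. mzv_trunc N ks) \<longlonglongrightarrow> mzv ks"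
  using mzv_trunc_LIMSEQ_snoc[of "butlast ks" "last ks"] assms by (auto dest: in_set_butlastD)

lemma mzv_in_mzv_algebra:
  assumes "ks \<noteq> []" "\<forall>k\<in>set ks. k \<ge> 1" "last ks \<ge> 2"
  shows "mzv ks \<in> mzv_algebra"
  unfolding mzv_def by (rule mzv_algebra.mzv[OF assms])

lemma uminus_mzv_algebra: "x \<in> mzv_algebra \<Longrightarrow> - x \<in> mzv_algebra"
  using mzv_algebra.mult[of "-1" x] mzv_algebra.rat[of "-1"] by simp

section \<open>Harmonic products in small depth\<close>

lemma mzv_trunc_0_Cons [simp]: "mzv_trunc 0 (k # ks) = 0"
  using mzv_trunc_0[of "butlast (k # ks)" "last (k # ks)"]
  by (simp del: last.simps butlast.simps)

lemma mzv_trunc_Suc_small: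
  "mzv_trunc (Suc N) [a] = mzv_trunc N [a] + 1 / real (Suc N) ^ a"
  "mzv_trunc (Suc N) [a, b] = mzv_trunc N [a, b] + mzv_trunc N [a] / real (Suc N) ^ b"
  "mzv_trunc (Suc N) [a, b, c] = mzv_trunc N [a, b, c] + mzv_trunc N [a, b] / real (Suc N) ^ c"
  using mzv_trunc_Suc[of N "[]" a] mzv_trunc_Suc[of N "[a]" b] mzv_trunc_Suc[of N "[a, b]" c]
  by simp_all

lemma mzv_trunc_1: "mzv_trunc N [Suc 0] = harm N"
  using mzv_trunc_snoc[of N "[]" 1] by (simp add: harm_eq_sum)

text \<open>The three terms correspond to the two summation indices being in one order, in the
  other, or equal.\<close>

lemma stuffle_1_1:
  "mzv_trunc N [a] * mzv_trunc N [b] = mzv_trunc N [a, b] + mzv_trunc N [b, a] + mzv_trunc N [a + b]"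
proof (induction N)
  case (Suc N)
  then show ?case
    by (simp add: mzv_trunc_Suc_small ring_distribs power_add add_divide_distrib del: of_nat_Suc)
qed simp

text \<open>The index of \<open>c\<close> falls into one of three gaps around the other two indices
  or coincides with one of them.\<close>

lemma stuffle_2_1:
  "mzv_trunc N [a, b] * mzv_trunc N [c] = mzv_trunc N [a, b, c] + mzv_trunc N [a, c, b]
     + mzv_trunc N [c, a, b] + mzv_trunc N [a, b + c] + mzv_trunc N [a + c, b]"
proof (induction N)
  case (Suc N)
  let ?x = "inverse (real (Suc N))"
  \<comment> \<open>The increment of the left side contains this product of depth-one sums; once it
    is expanded, both increments agree term by term.\<close>
  have "mzv_trunc N [a] * mzv_trunc N [c] * ?x ^ b
      = (mzv_trunc N [a, c] + mzv_trunc N [c, a] + mzv_trunc N [a + c]) * ?x ^ b"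
    by (simp only: stuffle_1_1)
  with Suc show ?case
    by (simp add: mzv_trunc_Suc_small ring_distribs power_add divide_inverse power_inverse
        mult_ac del: of_nat_Suc)
qed simp

section \<open>Computation of regularized values\<close>

lemma zeta_star_linear:
  assumes "\<forall>i\<in>set ks. i \<ge> 1" "k \<ge> 2"
    and split: "\<And>N. mzv_trunc N (ks @ [k]) * harm N = mzv_trunc N ls + d N"
    and d: "d \<longlonglongrightarrow> D" "D \<in> mzv_algebra"
  shows "(\<lambda>N. mzv_trunc N ls - mzv (ks @ [k]) * harm N) \<longlonglongrightarrow> - D"
    and "zeta_star ls = - D"
proof -
  \<comment> \<open>Replacing the truncated convergent value by its limit changes the product with
    \<open>harm N\<close> only by tail times \<open>harm N\<close>, which vanishes in the limit.
    What remains is linear in \<open>harm N\<close>.\<close>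
  have "(\<lambda>N. - ((mzv (ks @ [k]) - mzv_trunc N (ks @ [k])) * harm N) - d N) \<longlonglongrightarrow> - 0 - D"
    by (intro tendsto_intros mzv_tail_harm assms)
  moreover have "mzv_trunc N ls - mzv (ks @ [k]) * harm N =
      - ((mzv (ks @ [k]) - mzv_trunc N (ks @ [k])) * harm N) - d N" for N
    using split[of N] by (simp add: algebra_simps)
  ultimately show lim: "(\<lambda>N. mzv_trunc N ls - mzv (ks @ [k]) * harm N) \<longlonglongrightarrow> - D"
    by simp
  have "zeta_star_poly ls = [:- D, mzv (ks @ [k]):]"
  proof (rule zeta_star_poly_eqI)
    have "mzv (ks @ [k]) \<in> mzv_algebra" by (rule mzv_in_mzv_algebra) (use assms in auto)
    then show "coeff [:- D, mzv (ks @ [k]):] i \<in> mzv_algebra" for i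
      using d(2) by (auto simp: coeff_pCons uminus_mzv_algebra mzv_algebra.rat split: nat.split)
    show "(\<lambda>N. mzv_trunc N ls - poly [:- D, mzv (ks @ [k]):] (harm N)) \<longlonglongrightarrow> 0"
      using tendsto_add[OF lim tendsto_const[of D]] by (simp add: algebra_simps)
  qed
  then show "zeta_star ls = - D" by (simp add: zeta_star_def)
qed

lemma zeta_star_k_1:
  assumes "k \<ge> 2"
  shows "(\<lambda>N. mzv_trunc N [k, 1] - mzv [k] * harm N) \<longlonglongrightarrow> zeta_star [k, 1]"
    and "zeta_star [k, 1] = - (mzv [1, k] + mzv [k + 1])"
proof -
  note lin = zeta_star_linear[of "[]" k "[k, 1]" "\<lambda>N. mzv_trunc N [1, k] + mzv_trunc N [k + 1]"
      "mzv [1, k] + mzv [k + 1]"]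
  have *: "mzv_trunc N [k] * harm N = mzv_trunc N [k, 1] + (mzv_trunc N [1, k] + mzv_trunc N [k + 1])" for N
    using stuffle_1_1[of N k 1] by (simp add: mzv_trunc_1)
  have **: "(\<lambda>N. mzv_trunc N [1, k] + mzv_trunc N [k + 1]) \<longlonglongrightarrow> mzv [1, k] + mzv [k + 1]"
    "mzv [1, k] + mzv [k + 1] \<in> mzv_algebra"
    using assms by (auto intro!: tendsto_add mzv_trunc_LIMSEQ mzv_algebra.add mzv_in_mzv_algebra)
  show "zeta_star [k, 1] = - (mzv [1, k] + mzv [k + 1])"
    using lin(2) assms * ** by simp
  then show "(\<lambda>N. mzv_trunc N [k, 1] - mzv [k] * harm N) \<longlonglongrightarrow> zeta_star [k, 1]"
    using lin(1) assms * ** by simp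
qed

text \<open>In the product of \<open>[j, k]\<close> with \<open>[1]\<close>, every term other than
  \<open>[j, k, 1]\<close> ends in an exponent at least 2, so their sum converges and serves as
  \<open>d\<close>.\<close>

lemma zeta_star_j_k_1:
  assumes "j \<ge> 1" "k \<ge> 2"
  shows "(\<lambda>N. mzv_trunc N [j, k, 1] - mzv [j, k] * harm N) \<longlonglongrightarrow> zeta_star [j, k, 1]"
proof -
  let ?d = "\<lambda>N. mzv_trunc N [j, 1, k] + mzv_trunc N [1, j, k] + mzv_trunc N [j, k + 1] + mzv_trunc N [j + 1, k]"
  let ?D = "mzv [j, 1, k] + mzv [1, j, k] + mzv [j, k + 1] + mzv [j + 1, k]"
  note lin = zeta_star_linear[of "[j]" k "[j, k, 1]" ?d ?D]
  have *: "mzv_trunc N [j, k] * harm N = mzv_trunc N [j, k, 1] + ?d N" for N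
    using stuffle_2_1[of N j k 1] by (simp add: mzv_trunc_1)
  have **: "?d \<longlonglongrightarrow> ?D" "?D \<in> mzv_algebra"
    using assms by (auto intro!: tendsto_add mzv_trunc_LIMSEQ mzv_algebra.add mzv_in_mzv_algebra)
  have "zeta_star [j, k, 1] = - ?D"
    using lin(2) assms * ** by simp
  then show ?thesis
    using lin(1) assms * ** by simp
qed

lemma zeta_star_1_1_1: "zeta_star [1, 1, 1] = mzv [3] / 3"
proof -
  \<comment> \<open>Newton's identity \<open>e3 = (p1^3 - 3 p1 p2 + 2 p3) / 6\<close> with
    \<open>p1 = harm N\<close> as the variable and the power sums \<open>p2\<close>,
    \<open>p3\<close> replaced by their limits.\<close>
  let ?p = "[:mzv [3] / 3, - mzv [2] / 2, 0, 1 / 6:]"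
  let ?H = "\<lambda>k N. mzv_trunc N [k]"
  have e2: "mzv_trunc N [1, 1] = (?H 1 N ^ 2 - ?H 2 N) / 2" for N
    using stuffle_1_1[of N 1 1] by (simp add: power2_eq_square numeral_2_eq_2)
  have e3: "mzv_trunc N [1, 1, 1] = (harm N ^ 3 - 3 * harm N * ?H 2 N + 2 * ?H 3 N) / 6" for N
  proof -
    have "mzv_trunc N [1, 1] * harm N = mzv_trunc N [1, 2] + mzv_trunc N [2, 1] + 3 * mzv_trunc N [1, 1, 1]"
      using stuffle_2_1[of N 1 1 1] by (simp add: mzv_trunc_1 numeral_2_eq_2)
    moreover have "?H 2 N * harm N = mzv_trunc N [1, 2] + mzv_trunc N [2, 1] + ?H 3 N"
      using stuffle_1_1[of N 2 1] by (simp add: mzv_trunc_1)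
    moreover have "2 * (mzv_trunc N [1, 1] * harm N) = harm N ^ 3 - ?H 2 N * harm N"
      unfolding e2 by (simp add: mzv_trunc_1 field_simps power2_eq_square power3_eq_cube)
    ultimately show ?thesis by (simp add: mult.assoc mult.commute[of "harm N"])
  qed
  have "zeta_star_poly [1, 1, 1] = ?p"
  proof (rule zeta_star_poly_eqI)
    have "(1 / 3) * mzv [3] \<in> mzv_algebra" "(- 1 / 2) * mzv [2] \<in> mzv_algebra"
      by (rule mzv_algebra.mult[OF mzv_algebra.rat mzv_in_mzv_algebra]; simp)+
    then show "coeff ?p i \<in> mzv_algebra" for i
      by (auto simp: coeff_pCons mzv_algebra.rat split: nat.split)
    \<comment> \<open>The error in \<open>p2\<close> is multiplied by the unbounded
      \<open>harm N\<close>, so mere convergence is not enough and the tail estimate enters.\<close>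
    have "(\<lambda>N. (1/2) * ((mzv [2] - ?H 2 N) * harm N) + (1/3) * (?H 3 N - mzv [3]))
        \<longlonglongrightarrow> (1/2) * 0 + (1/3) * (mzv [3] - mzv [3])"
      using mzv_tail_harm[of "[]" 2] by (intro tendsto_intros mzv_trunc_LIMSEQ) auto
    moreover have "mzv_trunc N [1, 1, 1] - poly ?p (harm N) =
        (1/2) * ((mzv [2] - ?H 2 N) * harm N) + (1/3) * (?H 3 N - mzv [3])" for N
      unfolding e3 by (simp add: algebra_simps power3_eq_cube diff_divide_distrib add_divide_distrib)
    ultimately show "(\<lambda>N. mzv_trunc N [1, 1, 1] - poly ?p (harm N)) \<longlonglongrightarrow> 0"
      by simp
  qed
  then show ?thesis by (simp add: zeta_star_def)
qed

section \<open>Euler's evaluation of zeta(1,2) by a Tornheim double sum\<close>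

lemma tornheim_inner:
  assumes "n \<ge> 1"
  shows "(\<Sum>k=1..N. 1 / (real n * real k * real (n + k))) = (harm N + harm n - harm (N + n)) / real n ^ 2"
proof -
  have "harm (N + n) = harm n + (\<Sum>k=1..N. 1 / real (n + k))"
    by (induction N) (auto simp: harm_Suc inverse_eq_divide add_ac)
  moreover have "harm N = (\<Sum>k=1..N. 1 / real k)"
    by (simp add: harm_def inverse_eq_divide)
  ultimately have "harm N + harm n - harm (N + n) = (\<Sum>k=1..N. 1 / real k - 1 / real (n + k))"
    by (simp add: sum_subtractf)
  also have "\<dots> / real n ^ 2 = (\<Sum>k=1..N. (1 / real k - 1 / real (n + k)) / real n ^ 2)"
    by (rule sum_divide_distrib)
  \<comment> \<open>Partial fractions: \<open>1/k - 1/(n+k) = n/(k(n+k))\<close>, which cancels one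
    of the two factors \<open>n\<close> below.\<close>
  also have "\<dots> = (\<Sum>k=1..N. 1 / (real n * real k * real (n + k)))"
    using assms by (intro sum.cong) (auto simp: divide_simps power2_eq_square)
  finally show ?thesis by simp
qed

text \<open>Summing over \<open>k\<close> first gives \<open>harm n / n^2\<close> up to the error
  \<open>(harm (N + n) - harm N) / n^2\<close>. That error is at most \<open>1/(n N)\<close>, so the
  errors add up to at most \<open>harm N / N\<close>.\<close>

lemma tornheim_square:
  "(\<lambda>N. \<Sum>n=1..N. \<Sum>k=1..N. 1 / (real n * real k * real (n + k))) \<longlonglongrightarrow> mzv [1, 2] + mzv [3]"
proof -
  let ?T = "\<lambda>N. \<Sum>n=1..N. \<Sum>k=1..N. 1 / (real n * real k * real (n + k))"
  let ?M = "\<lambda>N. mzv_trunc N [1, 2] + mzv_trunc N [3]"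
  \<comment> \<open>The part of \<open>harm n\<close> below its last term produces
    \<open>[1, 2]\<close>, and the last term \<open>1/n\<close> produces \<open>[3]\<close>.\<close>
  have M: "?M N = (\<Sum>n=1..N. harm n / real n ^ 2)" for N
    by (induction N) (auto simp: mzv_trunc_Suc_small mzv_trunc_1 harm_Suc inverse_eq_divide
        add_divide_distrib power2_eq_square power3_eq_cube mult.assoc simp del: of_nat_Suc)
  have T: "?T N = ?M N - (\<Sum>n=1..N. (harm (N + n) - harm N) / real n ^ 2)" for N
    unfolding M sum_subtractf[symmetric]
  proof (intro sum.cong refl)
    fix n assume "n \<in> {1..N}"
    then have "1 \<le> n" by simp
    show "(\<Sum>k=1..N. 1 / (real n * real k * real (n + k))) =
        harm n / real n ^ 2 - (harm (N + n) - harm N) / real n ^ 2"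
      unfolding tornheim_inner[OF \<open>1 \<le> n\<close>] by (simp add: add_divide_distrib diff_divide_distrib)
  qed
  have h: "0 \<le> harm (N + n) - (harm N :: real)" "harm (N + n) - harm N \<le> real n / real N" if "N > 0" for N n
  proof -
    show "0 \<le> harm (N + n) - (harm N :: real)" using harm_mono[of N "N + n", where 'a = real] by simp
    show "harm (N + n) - harm N \<le> real n / real N"
    proof (induction n)
      case (Suc n)
      have "inverse (real (Suc (N + n))) \<le> 1 / real N" using that by (simp add: field_simps)
      with Suc show ?case by (simp add: harm_Suc add_divide_distrib)
    qed simp
  qed
  have M_lim: "?M \<longlonglongrightarrow> mzv [1, 2] + mzv [3]"
    by (intro tendsto_add mzv_trunc_LIMSEQ) auto
  have err: "(\<lambda>N. harm N / real N :: real) \<longlonglongrightarrow> 0"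
  proof (rule tendsto_sandwich[OF _ _ tendsto_const])
    show "\<forall>\<^sub>F N in sequentially. harm N / real N \<le> (ln (real N) + 1) / real N"
      using eventually_gt_at_top[of 0]
    proof eventually_elim
      case (elim N)
      then show ?case using harm_le_ln[of "N - 1"] by (intro divide_right_mono) auto
    qed
    show "(\<lambda>N. (ln (real N) + 1) / real N) \<longlonglongrightarrow> 0" by real_asymp
  qed (auto simp: harm_nonneg)
  have "(\<lambda>N. \<Sum>n=1..N. (harm (N + n) - harm N) / real n ^ 2 :: real) \<longlonglongrightarrow> 0"
  proof (rule tendsto_sandwich[OF _ _ tendsto_const err])
    show "\<forall>\<^sub>F N in sequentially. 0 \<le> (\<Sum>n=1..N. (harm (N + n) - harm N) / real n ^ 2 :: real)"
      using eventually_gt_at_top[of 0] by eventually_elim (auto intro!: sum_nonneg simp: h(1)[simplified])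
    show "\<forall>\<^sub>F N in sequentially. (\<Sum>n=1..N. (harm (N + n) - harm N) / real n ^ 2 :: real) \<le> harm N / real N"
      using eventually_gt_at_top[of 0]
    proof eventually_elim
      case (elim N)
      have "(\<Sum>n=1..N. (harm (N + n) - harm N) / real n ^ 2 :: real) \<le> (\<Sum>n=1..N. (real n / real N) / real n ^ 2)"
        using h(2)[OF elim] by (intro sum_mono divide_right_mono) auto
      also have "\<dots> = (\<Sum>n=1..N. inverse (real n) / real N)"
        by (intro sum.cong) (auto simp: field_simps power2_eq_square)
      also have "\<dots> = harm N / real N"
        by (simp add: harm_def sum_divide_distrib)
      finally show ?case .
    qed
  qed
  from tendsto_diff[OF M_lim this] show ?thesis unfolding T by simp
qed

text \<open>On the diagonal \<open>n + k = m\<close>, partial fractions give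
  \<open>1/(n(m-n)) = (1/n + 1/(m-n))/m\<close>. The reflection of \<open>n\<close> to
  \<open>m - n\<close> shows that both halves contribute the harmonic number of index
  \<open>m - 1\<close>, whence the factor 2.\<close>

lemma tornheim_triangle:
  "(\<Sum>m=1..N. \<Sum>n=1..<m. 1 / (real n * real (m - n) * real m)) = 2 * mzv_trunc N [1, 2]"
proof (induction N)
  case (Suc N)
  let ?m = "Suc N"
  have "(\<Sum>n=1..<?m. 1 / (real n * real (?m - n) * real ?m))
      = (\<Sum>n=1..<?m. (1 / real n + 1 / real (?m - n)) / real ?m ^ 2)"
    by (intro sum.cong) (auto simp: of_nat_diff divide_simps power2_eq_square)
  also have "\<dots> = ((\<Sum>n=1..<?m. 1 / real n) + (\<Sum>n=1..<?m. 1 / real (?m - n))) / real ?m ^ 2"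
    by (simp only: sum.distrib sum_divide_distrib[symmetric])
  also have "(\<Sum>n=1..<?m. 1 / real (?m - n)) = (\<Sum>n=1..<?m. 1 / real n)"
    by (rule sum.reindex_bij_witness[of _ "\<lambda>n. ?m - n" "\<lambda>n. ?m - n"]) auto
  also have "(\<Sum>n=1..<?m. 1 / real n) = harm N"
    by (simp add: harm_def inverse_eq_divide atLeastLessThanSuc_atLeastAtMost)
  finally show ?case
    using Suc mzv_trunc_1[of N] by (simp add: mzv_trunc_Suc_small)
qed simp

text \<open>Euler's \<open>\<zeta>(1,2) = \<zeta>(3)\<close>: the sum of \<open>1 / (n k (n + k))\<close> evaluated over squares gives
  \<open>\<zeta>(1,2) + \<zeta>(3)\<close>, and over triangles \<open>n + k \<le> N\<close> it gives \<open>2 \<zeta>(1,2)\<close>.\<close>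
lemma mzv_1_2: "mzv [1, 2] = mzv [3]"
proof -
  define f where "f = (\<lambda>(n, k). 1 / (real n * real k * real (n + k)))"
  let ?S = "\<lambda>N. {1..N} \<times> {1..N}"
  let ?D = "\<lambda>N. {(n, k). 1 \<le> n \<and> 1 \<le> k \<and> n + k \<le> (N::nat)}"
  have fin: "finite (?D N)" for N
    by (rule finite_subset[of _ "{..N} \<times> {..N}"]) auto
  have S: "sum f (?S N) = (\<Sum>n=1..N. \<Sum>k=1..N. 1 / (real n * real k * real (n + k)))" for N
    unfolding f_def by (rule sum.cartesian_product[symmetric])
  have D: "sum f (?D N) = 2 * mzv_trunc N [1, 2]" for N
  proof -
    have "sum f (?D N) = (\<Sum>(m, n)\<in>Sigma {1..N} (\<lambda>m. {1..<m}). 1 / (real n * real (m - n) * real m))"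
      by (rule sum.reindex_bij_witness[of _ "\<lambda>(m, n). (n, m - n)" "\<lambda>(n, k). (n + k, n)"])
         (auto simp: f_def)
    also have "\<dots> = (\<Sum>m=1..N. \<Sum>n=1..<m. 1 / (real n * real (m - n) * real m))"
      by (rule sum.Sigma[symmetric]) auto
    finally show ?thesis using tornheim_triangle[of N] by simp
  qed
  have f0: "f p \<ge> 0" for p by (auto simp: f_def split: prod.split)
  \<comment> \<open>The square of side \<open>N\<close> contains the triangle of size
    \<open>N\<close> and lies in the triangle of size \<open>2 * N\<close>. As the terms are
    nonnegative, the square sums are squeezed between two sequences with the same limit.\<close>
  have "(\<lambda>N. sum f (?S N)) \<longlonglongrightarrow> 2 * mzv [1, 2]"
  proof (rule tendsto_sandwich)
    have lim: "(\<lambda>N. 2 * mzv_trunc N [1, 2]) \<longlonglongrightarrow> 2 * mzv [1, 2]"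
      by (intro tendsto_intros mzv_trunc_LIMSEQ) auto
    then show "(\<lambda>N. sum f (?D N)) \<longlonglongrightarrow> 2 * mzv [1, 2]" unfolding D .
    have "strict_mono (\<lambda>N::nat. 2 * N)" by (simp add: strict_mono_def)
    from LIMSEQ_subseq_LIMSEQ[OF lim this]
    show "(\<lambda>N. sum f (?D (2 * N))) \<longlonglongrightarrow> 2 * mzv [1, 2]" unfolding D by (simp add: o_def)
    show "\<forall>\<^sub>F N in sequentially. sum f (?D N) \<le> sum f (?S N)"
      by (intro always_eventually allI sum_mono2) (auto intro: f0)
    show "\<forall>\<^sub>F N in sequentially. sum f (?S N) \<le> sum f (?D (2 * N))"
      by (intro always_eventually allI sum_mono2 fin) (auto intro: f0)
  qed
  from LIMSEQ_unique[OF this tornheim_square[folded S]] show ?thesis by simp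
qed

section \<open>Zeta at integers and the series for \<open>C_plus\<close>\<close>

lemma zeta_of_nat:
  assumes "k \<ge> 2"
  shows "zeta (of_nat k) = of_real (mzv [k])"
proof -
  have "(\<lambda>N. \<Sum>n<N. 1 / real (Suc n) ^ k) \<longlonglongrightarrow> mzv [k]"
    using mzv_trunc_LIMSEQ[of "[k]"] mzv_trunc_snoc[of _ "[]" k] assms by simp
  then have "(\<lambda>n. 1 / real (Suc n) ^ k) sums mzv [k]" by (simp add: sums_def)
  then have "(\<lambda>n. of_real (1 / real (Suc n) ^ k) :: complex) sums of_real (mzv [k])"
    by (rule sums_of_real)
  also have "(\<lambda>n. of_real (1 / real (Suc n) ^ k)) = (\<lambda>n. of_nat (Suc n) powr (- of_nat k) :: complex)"
    by (simp add: powr_minus powr_nat' inverse_eq_divide del: of_nat_Suc)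
  finally show ?thesis
    using assms by (simp add: zeta_def zeta_series_def sums_unique[symmetric] del: of_nat_Suc)
qed

lemma gen_harm_of_nat: "gen_harm (of_nat k) N = of_real (mzv_trunc N [k])"
proof (induction N)
  case (Suc N)
  then show ?case
    by (simp add: gen_harm_def mzv_trunc_Suc_small powr_minus powr_nat' inverse_eq_divide del: of_nat_Suc)
qed (simp add: gen_harm_def)

lemma C_plus_of_nat:
  assumes "k \<ge> 2"
  shows "C_plus (of_nat k - 1) = (zeta (of_nat k))\<^sup>2 * (2 * stieltjes 0 - 1)
           + of_real (2 * zeta_star [k, k, 1] + zeta_star [2 * k, 1])"
proof -
  let ?H = "\<lambda>n. mzv_trunc n [k]"
  have H2: "?H n ^ 2 = 2 * mzv_trunc n [k, k] + mzv_trunc n [2 * k]" for n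
    unfolding power2_eq_square mult_2 by (rule stuffle_1_1)
  have "(\<lambda>n. ?H n ^ 2) \<longlonglongrightarrow> mzv [k] ^ 2"
    using assms by (intro tendsto_intros mzv_trunc_LIMSEQ) auto
  moreover have "(\<lambda>n. ?H n ^ 2) \<longlonglongrightarrow> 2 * mzv [k, k] + mzv [2 * k]"
    unfolding H2 using assms by (intro tendsto_intros mzv_trunc_LIMSEQ) auto
  \<comment> \<open>The harmonic product passes to the limit, so the subtracted constant splits in
    the same way as the square \<open>H2\<close>.\<close>
  ultimately have Z2: "mzv [k] ^ 2 = 2 * mzv [k, k] + mzv [2 * k]"
    by (rule LIMSEQ_unique)
  \<comment> \<open>Dividing \<open>mzv_trunc n [k, k]\<close> by \<open>Suc n\<close> gives exactly
    the increment of \<open>mzv_trunc N [k, k, 1]\<close>, and likewise for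
    \<open>[2 * k, 1]\<close>; the constants collect into multiples of
    \<open>harm N\<close>.\<close>
  have partial: "(\<Sum>n<N. (?H n ^ 2 - mzv [k] ^ 2) / real (Suc n)) =
      2 * (mzv_trunc N [k, k, 1] - mzv [k, k] * harm N)
        + (mzv_trunc N [2 * k, 1] - mzv [2 * k] * harm N)" for N
    unfolding H2 Z2
    by (induction N) (simp_all add: harm_def mzv_trunc_Suc_small inverse_eq_divide
        diff_divide_distrib add_divide_distrib algebra_simps del: of_nat_Suc)
  have "(\<lambda>N. \<Sum>n<N. (?H n ^ 2 - mzv [k] ^ 2) / real (Suc n))
      \<longlonglongrightarrow> 2 * zeta_star [k, k, 1] + zeta_star [2 * k, 1]"
    unfolding partial using assms
    by (intro tendsto_intros zeta_star_k_1 zeta_star_j_k_1) auto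
  then have "(\<lambda>n. (?H n ^ 2 - mzv [k] ^ 2) / real (Suc n)) sums (2 * zeta_star [k, k, 1] + zeta_star [2 * k, 1])"
    by (simp only: sums_def)
  then have "(\<Sum>n. (?H n ^ 2 - mzv [k] ^ 2) / real (Suc n)) = 2 * zeta_star [k, k, 1] + zeta_star [2 * k, 1]"
    by (rule sums_unique[symmetric])
  \<comment> \<open>At integer arguments \<open>zeta\<close> and \<open>gen_harm\<close> take real
    values, so the squared norms in \<open>C_plus\<close> are plain squares.\<close>
  then show ?thesis
    using assms by (simp add: C_plus_def zeta_of_nat gen_harm_of_nat del: of_nat_Suc)
qed

theorem theorem1p4:
  shows "(\<forall>k::nat. k \<ge> 2 \<longrightarrow>
           C_plus (of_nat k - 1) =
             (zeta (of_nat k))\<^sup>2 * (2 * stieltjes 0 - 1)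
               + of_real (2 * zeta_star [k, k, 1] + zeta_star [2 * k, 1]))
       \<and> of_real (2 * zeta_star [1, 1, 1] + zeta_star [2, 1]) = - (4 / 3) * zeta 3
       \<and> C_zero = - 2 + 4 * stieltjes 0 - 3 * (stieltjes 0)\<^sup>2 + 4 / 3 * stieltjes 0 ^ 3
           + 2 * (1 - stieltjes 0) * stieltjes 1 + stieltjes 2
           + of_real (2 * zeta_star [1, 1, 1] + zeta_star [2, 1])"
proof -
  \<comment> \<open>With zeta(1,2) = zeta(3), the coefficient of zeta(3) is
    \<open>2/3 - 2 = -4/3\<close>.\<close>
  have "2 * zeta_star [1, 1, 1] + zeta_star [2, 1] = - (4 / 3) * mzv [3]"
    using zeta_star_1_1_1 zeta_star_k_1(2)[of 2] mzv_1_2 by simp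
  moreover have "zeta 3 = of_real (mzv [3])"
    using zeta_of_nat[of 3] by simp
  ultimately have "of_real (2 * zeta_star [1, 1, 1] + zeta_star [2, 1]) = - (4 / 3) * zeta 3"
    by (simp only: of_real_mult of_real_minus of_real_divide of_real_numeral)
  then show ?thesis
    using C_plus_of_nat by (simp add: C_zero_def)
qed

end
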